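(* Let $G_1$ and $G_2$ be abelian groups. If there is a chromatic isomorphism from some connected Cayley graph $\operatorname{Cay}(G_1;S_1)$ of $G_1$ to some Cayley graph $\operatorname{Cay}(G_2;S_2)$ of $G_2$ (with $S_1 \subseteq G_1$ and $S_2 \subseteq G_2$ symmetric), then $G_1$ is isomorphic to $G_2$.
   Context: Groups are abelian, written additively, and may be infinite. A subset $S$ of an abelian group $G$ is symmetric if $S = -S$. For symmetric $S \subseteq G$, the abelian Cayley graph $\operatorname{Cay}(G;S)$ is the undirected graph whose vertices are the elements of $G$, with an edge joining $g$ and $g+s$ for all $g \in G$ and $s \in S$. (It is connected if and only if $S$ generates $G$.) The edge joining $g$ and $g+s$ is coloured with the set $\{\pm s\}$. A graph isomorphism $\varphi$ from an abelian Cayley graph $\operatorname{Cay}(G_1;S_1)$ to an abelian Cayley graph $\operatorname{Cay}(G_2;S_2)$ is chromatic if there is a bijection $\pi \colon S_1 \to S_2$ such that $\varphi(g+s) \in \{\varphi(g) \pm \pi(s)\}$ for all $g \in G_1$ and $s \in S_1$.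
   Formalization: The bijection π is also required to satisfy π(−s) = −π(s), automatic unless s = −s; without it the claim fails: Z₂×Z₂ and Z₄ with all nonzero elements, φ and π sending (1,0), (0,1), (1,1) to 1, 3, 2 and φ(0) = 0. *)

theory Defs
  imports "HOL-Algebra.Coset" "Graph_Theory.Digraph_Isomorphism"
begin

text \<open>
  Undirected graphs are symmetric digraphs whose arcs are pairs of vertices. Groups are written
  multiplicatively, as in \<^theory>\<open>HOL-Algebra.Group\<close>, so \<open>g \<otimes> s\<close> is the $g + s$ and
  \<open>inv s\<close> the $-s$ of additive notation.
\<close>

definition Cay :: "('a, 'm) monoid_scheme \<Rightarrow> 'a set \<Rightarrow> 'a pair_pre_digraph" where
  "Cay G S = \<lparr> pverts = carrier G, parcs = {(g, g \<otimes>\<^bsub>G\<^esub> s) | g s. g \<in> carrier G \<and> s \<in> S} \<rparr>"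

definition symmetric_subset :: "('a, 'm) monoid_scheme \<Rightarrow> 'a set \<Rightarrow> bool" where
  "symmetric_subset G S \<longleftrightarrow> S \<subseteq> carrier G \<and> S = set_inv\<^bsub>G\<^esub> S"

definition graph_isomorphism ::
  "('a \<Rightarrow> 'b) \<Rightarrow> 'a pair_pre_digraph \<Rightarrow> 'b pair_pre_digraph \<Rightarrow> bool" where
  "graph_isomorphism \<phi> X Y \<longleftrightarrow>
     (\<exists>h. pre_digraph.digraph_isomorphism (with_proj X) h \<and> app_iso h (with_proj X) = with_proj Y \<and>
          iso_verts h = \<phi>)"

text \<open>
  The conjunct \<open>\<pi> (inv s) = inv (\<pi> s)\<close> says that \<open>\<pi>\<close> carries the colour \<open>{s, inv s}\<close> onto the colour
  \<open>{\<pi> s, inv (\<pi> s)}\<close>, i.e. that \<open>\<pi>\<close> induces a bijection between the colours. When \<open>s \<noteq> inv s\<close> it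
  follows from the other conjuncts; when \<open>s = inv s\<close> it says that \<open>\<pi> s\<close> is also its own inverse.
  It cannot be dropped: otherwise two involutions of \<open>S\<^sub>1\<close> could be sent to \<open>t\<close> and \<open>inv t\<close>. For
  example, let \<open>S\<^sub>1\<close> and \<open>S\<^sub>2\<close> be the sets of nonzero elements of $Z_2 \times Z_2$ and of $Z_4$, and
  let \<open>\<phi>\<close> and \<open>\<pi>\<close> both send $(1,0), (0,1), (1,1)$ to $1, 3, 2$, with \<open>\<phi>\<close> fixing zero.
\<close>

definition chromatic_isomorphism ::
  "('a, 'm) monoid_scheme \<Rightarrow> 'a set \<Rightarrow> ('b, 'n) monoid_scheme \<Rightarrow> 'b set \<Rightarrow> ('a \<Rightarrow> 'b) \<Rightarrow> bool" where
  "chromatic_isomorphism G\<^sub>1 S\<^sub>1 G\<^sub>2 S\<^sub>2 \<phi> \<longleftrightarrow>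
     graph_isomorphism \<phi> (Cay G\<^sub>1 S\<^sub>1) (Cay G\<^sub>2 S\<^sub>2) \<and>
     (\<exists>\<pi>. bij_betw \<pi> S\<^sub>1 S\<^sub>2 \<and>
          (\<forall>s\<in>S\<^sub>1. \<pi> (inv\<^bsub>G\<^sub>1\<^esub> s) = inv\<^bsub>G\<^sub>2\<^esub> (\<pi> s)) \<and>
          (\<forall>g\<in>carrier G\<^sub>1. \<forall>s\<in>S\<^sub>1.
             \<phi> (g \<otimes>\<^bsub>G\<^sub>1\<^esub> s) \<in> {\<phi> g \<otimes>\<^bsub>G\<^sub>2\<^esub> \<pi> s, \<phi> g \<otimes>\<^bsub>G\<^sub>2\<^esub> inv\<^bsub>G\<^sub>2\<^esub> (\<pi> s)}))"

lemma pair_sym_digraph_Cay: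
  assumes "group G" and "symmetric_subset G S"
  shows "pair_sym_digraph (Cay G S)"
proof -
  interpret group G by fact
  have S: "S \<subseteq> carrier G" using assms(2) by (simp add: symmetric_subset_def)
  have inv_S: "inv\<^bsub>G\<^esub> s \<in> S" if "s \<in> S" for s
    using assms(2) that unfolding symmetric_subset_def SET_INV_def by auto
  have "(g \<otimes>\<^bsub>G\<^esub> s, g) \<in> parcs (Cay G S)" if "g \<in> carrier G" "s \<in> S" for g s
  proof -
    have "s \<in> carrier G" using S that by blast
    then have "g = (g \<otimes>\<^bsub>G\<^esub> s) \<otimes>\<^bsub>G\<^esub> inv\<^bsub>G\<^esub> s" "g \<otimes>\<^bsub>G\<^esub> s \<in> carrier G"
      using that by (auto simp: m_assoc)
    then show ?thesis unfolding Cay_def using inv_S[OF that(2)] by auto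
  qed
  then have "sym (parcs (Cay G S))" by (auto simp: sym_def Cay_def)
  moreover have "pair_wf_digraph (Cay G S)"
    using assms(2) by unfold_locales (auto simp: Cay_def symmetric_subset_def)
  ultimately show ?thesis
    by (simp add: pair_sym_digraph_def pair_sym_digraph_axioms_def symmetric_def arcs_ends_def
        arc_to_ends_def with_proj_def)
qed

lemma graph_isomorphism_iff:
  assumes "pair_wf_digraph X" "pair_wf_digraph Y"
  shows "graph_isomorphism \<phi> X Y \<longleftrightarrow>
     bij_betw \<phi> (pverts X) (pverts Y) \<and>
     (\<forall>u\<in>pverts X. \<forall>v\<in>pverts X. (u, v) \<in> parcs X \<longleftrightarrow> (\<phi> u, \<phi> v) \<in> parcs Y)" (is "?L \<longleftrightarrow> ?R")
proof
  interpret X: pair_wf_digraph X by fact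
  assume ?L
  then obtain h where h: "pre_digraph.digraph_isomorphism (with_proj X) h"
    "app_iso h (with_proj X) = with_proj Y" "iso_verts h = \<phi>"
    unfolding graph_isomorphism_def by blast
  have [simp]: "iso_tail h = fst" "iso_head h = snd"
    and im: "\<phi> ` pverts X = pverts Y" "iso_arcs h ` parcs X = parcs Y"
    using h(2,3) by (auto simp: app_iso_def with_proj_def)
  have arcs: "iso_arcs h a = (\<phi> (fst a), \<phi> (snd a))" if "a \<in> parcs X" for a
    using h(1,3) that by (auto simp: pre_digraph.digraph_isomorphism_def with_proj_def prod_eq_iff)
  have inj: "inj_on \<phi> (pverts X)"
    using h(1,3) by (auto simp: pre_digraph.digraph_isomorphism_def with_proj_def)
  have "(u, v) \<in> parcs X \<longleftrightarrow> (\<phi> u, \<phi> v) \<in> parcs Y" if "u \<in> pverts X" "v \<in> pverts X" for u v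
  proof
    assume "(u, v) \<in> parcs X"
    then show "(\<phi> u, \<phi> v) \<in> parcs Y" using arcs im(2) by force
  next
    assume "(\<phi> u, \<phi> v) \<in> parcs Y"
    then obtain a where a: "a \<in> parcs X" "\<phi> (fst a) = \<phi> u" "\<phi> (snd a) = \<phi> v"
      using arcs im(2) by force
    then have "fst a = u" "snd a = v"
      using inj that X.arc_fst_in_verts X.arc_snd_in_verts by (auto dest: inj_onD)
    then show "(u, v) \<in> parcs X" using a(1) by auto
  qed
  then show ?R using inj im(1) by (auto simp: bij_betw_def)
next
  interpret X: pair_wf_digraph X by fact
  interpret Y: pair_wf_digraph Y by fact
  assume R: ?R
  let ?f = "\<lambda>(u, v). (\<phi> u, \<phi> v)"
  let ?h = "\<lparr> iso_verts = \<phi>, iso_arcs = ?f, iso_head = snd, iso_tail = fst \<rparr>"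
  have inj: "inj_on \<phi> (pverts X)" and im: "\<phi> ` pverts X = pverts Y" using R by (auto simp: bij_betw_def)
  have "inj_on ?f (pverts X \<times> pverts X)" using inj by (auto simp: inj_on_def)
  moreover have sub: "parcs X \<subseteq> pverts X \<times> pverts X"
    using X.arc_fst_in_verts X.arc_snd_in_verts by fastforce
  ultimately have "inj_on ?f (parcs X)" by (rule inj_on_subset)
  then have "pre_digraph.digraph_isomorphism (with_proj X) ?h"
    using inj X.wf_digraph by (auto simp: pre_digraph.digraph_isomorphism_def with_proj_def)
  moreover have "?f ` parcs X = parcs Y"
  proof
    show "?f ` parcs X \<subseteq> parcs Y" using R sub by auto
    show "parcs Y \<subseteq> ?f ` parcs X"
    proof
      fix b assume b: "b \<in> parcs Y"
      then have "fst b \<in> \<phi> ` pverts X" "snd b \<in> \<phi> ` pverts X"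
        using im Y.arc_fst_in_verts Y.arc_snd_in_verts by auto
      then obtain u v where uv: "u \<in> pverts X" "v \<in> pverts X" "b = (\<phi> u, \<phi> v)"
        by (metis imageE prod.collapse)
      then have "(u, v) \<in> parcs X" using R b by auto
      then show "b \<in> ?f ` parcs X" using uv(3) by force
    qed
  qed
  then have "app_iso ?h (with_proj X) = with_proj Y" using im by (simp add: app_iso_def with_proj_def)
  ultimately show ?L unfolding graph_isomorphism_def by force
qed

end

theory Submission
  imports Defs
begin

text \<open>
  Translate \<open>\<phi>\<close> so that it fixes the identity, and call \<open>p\<close> a period if \<open>\<phi> (g p) = \<phi> g \<cdot> \<phi> p\<close> for all
  \<open>g\<close>. The sign with which \<open>\<phi>\<close> transports a step \<open>s\<close> is constant along the coset of \<open>s\<close>. Going around a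
  square with sides \<open>s\<close> and \<open>t\<close>, this sign can change in the direction \<open>t\<close> only if \<open>s\<^sup>2 = t\<^sup>2\<close> (up to
  inverting \<open>t\<close>), and then \<open>s\<^sup>4 = 1\<close>. Hence every generator \<open>s\<close> with \<open>s\<^sup>4 \<noteq> 1\<close> is a period, while
  if \<open>s\<^sup>4 = 1\<close> the sign is invisible in \<open>s\<^sup>2\<close>, so that \<open>s\<^sup>2\<close> is a period in every case.
  With \<open>P\<close> the group of periods and \<open>Q = \<phi> P\<close>, it follows that \<open>\<phi>\<close> induces an isomorphism of the
  elementary abelian 2-groups \<open>G\<^sub>1 / P\<close> and \<open>G\<^sub>2 / Q\<close>, and that \<open>\<phi> (x\<^sup>2) = (\<phi> x)\<^sup>2\<close> for all \<open>x\<close>. The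
  latter lets one extend \<open>\<phi>\<close> from \<open>P\<close> to a homomorphism congruent to \<open>\<phi>\<close> modulo \<open>Q\<close>, by choosing its
  values to be those of \<open>\<phi>\<close> on a basis of \<open>G\<^sub>1 / P\<close>; such a homomorphism is bijective. The graph of the
  extension is found by Zorn's lemma, among the subgroups of \<open>G\<^sub>1 \<times> G\<^sub>2\<close> of pairs \<open>(x, y)\<close> with
  \<open>y \<in> \<phi> x Q\<close> that meet \<open>P \<times> Q\<close> exactly in the graph of \<open>\<phi>\<close> on \<open>P\<close>.
\<close>

section \<open>Relative complements in abelian groups, by Zorn's lemma\<close>

text \<open>A maximal subgroup of \<open>R\<close> meeting \<open>T\<close> exactly in
  \<open>D\<close> works: if it missed some \<open>r\<close> modulo \<open>T\<close>, then the
  element \<open>r \<otimes> t\<close> supplied by \<open>sq\<close>, whose square lies in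
  \<open>D\<close>, could be adjoined to it.\<close>

lemma (in comm_group) relative_complement_exists:
  assumes R: "subgroup R G" and T: "subgroup T G" and D: "subgroup D G" "D \<subseteq> R" "D \<subseteq> T"
    and sq: "\<And>r. r \<in> R \<Longrightarrow> \<exists>t\<in>T. r \<otimes> t \<in> R \<and> (r \<otimes> t) \<otimes> (r \<otimes> t) \<in> D"
  obtains \<Gamma> where "subgroup \<Gamma> G" "\<Gamma> \<subseteq> R" "\<Gamma> \<inter> T = D" "\<And>r. r \<in> R \<Longrightarrow> \<exists>t\<in>T. r \<otimes> t \<in> \<Gamma>"
proof -
  define \<A> where "\<A> = {\<Gamma>. subgroup \<Gamma> G \<and> \<Gamma> \<subseteq> R \<and> \<Gamma> \<inter> T = D}"
  have "\<exists>\<Gamma>\<in>\<A>. \<forall>X\<in>\<A>. \<Gamma> \<subseteq> X \<longrightarrow> X = \<Gamma>"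
  proof (rule subset_Zorn_nonempty)
    show "\<A> \<noteq> {}" using D by (auto simp: \<A>_def)
  next
    fix \<C> assume ne: "\<C> \<noteq> {}" and ch: "subset.chain \<A> \<C>"
    \<comment> \<open>A member of the chain supplies both an element of the union and the inclusion
      of \<open>D\<close> in it.\<close>
    then obtain C where C: "C \<in> \<C>" "C \<in> \<A>" by (auto simp: subset_chain_def)
    have sub: "subgroup K G" if "K \<in> \<C>" for K using ch that by (auto simp: subset_chain_def \<A>_def)
    have "subgroup (\<Union>\<C>) G"
    proof (rule subgroupI)
      show "\<Union>\<C> \<subseteq> carrier G" using sub subgroup.subset by blast
      show "\<Union>\<C> \<noteq> {}" using C(1) sub subgroup.one_closed by blast
      show "inv a \<in> \<Union>\<C>" if "a \<in> \<Union>\<C>" for a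
        using that subgroup.m_inv_closed[OF sub] by auto
      show "a \<otimes> b \<in> \<Union>\<C>" if ab: "a \<in> \<Union>\<C>" "b \<in> \<Union>\<C>" for a b
      proof -
        obtain A B where "A \<in> \<C>" "B \<in> \<C>" "a \<in> A" "b \<in> B" using ab by blast
        moreover from this have "A \<subseteq> B \<or> B \<subseteq> A" using ch by (auto simp: subset_chain_def)
        ultimately obtain K where "K \<in> \<C>" "a \<in> K" "b \<in> K" by blast
        then show ?thesis using subgroup.m_closed[OF sub] by blast
      qed
    qed
    moreover have "\<Union>\<C> \<subseteq> R" "\<Union>\<C> \<inter> T = D"
      using ch C by (auto simp: subset_chain_def \<A>_def)
    ultimately show "\<Union>\<C> \<in> \<A>" by (simp add: \<A>_def)
  qed
  then obtain \<Gamma> where "\<Gamma> \<in> \<A>" and max: "\<And>X. X \<in> \<A> \<Longrightarrow> \<Gamma> \<subseteq> X \<Longrightarrow> X = \<Gamma>" by blast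
  then have \<Gamma>: "subgroup \<Gamma> G" "\<Gamma> \<subseteq> R" "\<Gamma> \<inter> T = D" by (simp_all add: \<A>_def)
  interpret \<Gamma>: subgroup \<Gamma> G by fact
  interpret R: subgroup R G by fact
  interpret T: subgroup T G by fact
  have "\<exists>t\<in>T. r \<otimes> t \<in> \<Gamma>" if r: "r \<in> R" for r
  proof (rule ccontr)
    assume no: "\<not> (\<exists>t\<in>T. r \<otimes> t \<in> \<Gamma>)"
    obtain t where t: "t \<in> T" "r \<otimes> t \<in> R" "(r \<otimes> t) \<otimes> (r \<otimes> t) \<in> D" using sq[OF r] by blast
    define a where "a = r \<otimes> t"
    have [simp]: "r \<in> carrier G" "t \<in> carrier G" "a \<in> carrier G"
      using r t by (auto simp: a_def)
    have aa: "a \<otimes> a \<in> \<Gamma>" using t(3) \<Gamma>(3) by (auto simp: a_def)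
    \<comment> \<open>Since \<open>a \<otimes> a\<close> lies in \<open>\<Gamma>\<close>, these two
      cosets already form a subgroup.\<close>
    let ?X = "\<Gamma> \<union> {\<gamma> \<otimes> a | \<gamma>. \<gamma> \<in> \<Gamma>}"
    have "\<one> \<otimes> a \<in> ?X" using \<Gamma>.one_closed by blast
    then have "a \<in> ?X" by simp
    have "subgroup ?X G"
    proof (rule subgroupI)
      show "?X \<subseteq> carrier G" by auto
      show "?X \<noteq> {}" using \<open>a \<in> ?X\<close> by blast
    next
      fix x assume "x \<in> ?X"
      then show "inv x \<in> ?X"
      proof
        assume "x \<in> {\<gamma> \<otimes> a | \<gamma>. \<gamma> \<in> \<Gamma>}"
        then obtain \<gamma> where \<gamma>: "\<gamma> \<in> \<Gamma>" "x = \<gamma> \<otimes> a" by blast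
        then have [simp]: "\<gamma> \<in> carrier G" by simp
        have "inv x = (inv \<gamma> \<otimes> inv (a \<otimes> a)) \<otimes> a" using \<gamma>(2) by (simp add: inv_mult m_assoc)
        moreover have "inv \<gamma> \<otimes> inv (a \<otimes> a) \<in> \<Gamma>" using \<gamma>(1) aa by blast
        ultimately show ?thesis by blast
      qed auto
    next
      fix x y assume "x \<in> ?X" "y \<in> ?X"
      then consider "x \<in> \<Gamma>" "y \<in> \<Gamma>" | \<gamma> where "x \<in> \<Gamma>" "\<gamma> \<in> \<Gamma>" "y = \<gamma> \<otimes> a"
        | \<gamma> where "y \<in> \<Gamma>" "\<gamma> \<in> \<Gamma>" "x = \<gamma> \<otimes> a"
        | \<gamma> \<delta> where "\<gamma> \<in> \<Gamma>" "\<delta> \<in> \<Gamma>" "x = \<gamma> \<otimes> a" "y = \<delta> \<otimes> a" by blast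
      then show "x \<otimes> y \<in> ?X"
      proof cases
        case 2
        then have "x \<otimes> y = (x \<otimes> \<gamma>) \<otimes> a" by (simp add: m_assoc)
        then show ?thesis using 2 by blast
      next
        case 3
        then have "x \<otimes> y = (y \<otimes> \<gamma>) \<otimes> a" by (simp add: m_ac)
        then show ?thesis using 3 by blast
      next
        case 4
        then have "x \<otimes> y = (\<gamma> \<otimes> \<delta>) \<otimes> (a \<otimes> a)" by (simp add: m_ac)
        then show ?thesis using 4 aa by simp
      qed simp
    qed
    moreover have "?X \<subseteq> R" using \<Gamma>(2) t(2) by (auto simp: a_def)
    moreover have "\<gamma> \<otimes> a \<notin> T" if \<gamma>: "\<gamma> \<in> \<Gamma>" for \<gamma>
    proof
      assume T: "\<gamma> \<otimes> a \<in> T"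
      have [simp]: "\<gamma> \<in> carrier G" using \<gamma> by simp
      \<comment> \<open>The element \<open>t \<otimes> inv (\<gamma> \<otimes> a)\<close> of
        \<open>T\<close> would carry \<open>r\<close> into \<open>\<Gamma>\<close>, against the
        choice of \<open>r\<close>.\<close>
      have "r \<otimes> (t \<otimes> inv (\<gamma> \<otimes> a)) = a \<otimes> inv (\<gamma> \<otimes> a)"
        by (simp add: a_def m_assoc)
      also have "\<dots> = inv \<gamma>" by (simp add: inv_mult m_lcomm[of a])
      finally have "r \<otimes> (t \<otimes> inv (\<gamma> \<otimes> a)) \<in> \<Gamma>" using \<gamma> by simp
      then show False using no T t(1) by blast
    qed
    ultimately have "?X \<in> \<A>" using \<Gamma>(3) by (auto simp: \<A>_def)
    then have "?X = \<Gamma>" using max by blast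
    then have "a \<in> \<Gamma>" using \<open>a \<in> ?X\<close> by blast
    then show False using no t(1) by (auto simp: a_def)
  qed
  then show thesis using that \<Gamma> by blast
qed

section \<open>Induction along a connected Cayley graph\<close>

text \<open>\<open>connected\<close> refers to the symmetric closure of the digraph. As
  \<open>S\<close> is symmetric, reachability is the same in the closure, so steps in
  \<open>S\<close> lead from the identity to every vertex.\<close>

lemma Cay_connected_induct:
  assumes "group G" "symmetric_subset G S" "Digraph_Component.connected (with_proj (Cay G S))"
    and "g \<in> carrier G" and one: "P \<one>\<^bsub>G\<^esub>"
    and step: "\<And>g s. g \<in> carrier G \<Longrightarrow> s \<in> S \<Longrightarrow> P g \<Longrightarrow> P (g \<otimes>\<^bsub>G\<^esub> s)"
  shows "P g"
proof -
  interpret group G by fact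
  interpret C: pair_sym_digraph "Cay G S" using assms(1,2) by (rule pair_sym_digraph_Cay)
  have "\<one>\<^bsub>G\<^esub> \<rightarrow>\<^sup>*\<^bsub>with_proj (mk_symmetric (with_proj (Cay G S)))\<^esub> g"
    using assms(3,4) by (auto simp: connected_def strongly_connected_def Cay_def)
  then have "\<one>\<^bsub>G\<^esub> \<rightarrow>\<^sup>*\<^bsub>with_proj (Cay G S)\<^esub> g"
    by (simp add: C.reachable_mk_symmetric_eq C.sym_arcs)
  then show ?thesis
    by (induction rule: C.reachable_induct) (use one step in \<open>auto simp: Cay_def\<close>)
qed


section \<open>Steps of a chromatic map that fixes the identity\<close>

text \<open>Connectedness enters as the induction principle \<open>induct_S\<close>, so that the
  setting speaks of groups and maps alone.\<close>

locale pointed_chromatic_map = G: comm_group G + H: comm_group H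
  for G :: "('a, 'm) monoid_scheme" (structure) and H :: "('b, 'n) monoid_scheme" +
  fixes S :: "'a set" and \<pi> :: "'a \<Rightarrow> 'b" and \<phi> :: "'a \<Rightarrow> 'b"
  assumes S_closed: "s \<in> S \<Longrightarrow> s \<in> carrier G"
    and \<pi>_closed: "s \<in> S \<Longrightarrow> \<pi> s \<in> carrier H"
    and \<pi>_inv: "s \<in> S \<Longrightarrow> \<pi> (inv s) = inv\<^bsub>H\<^esub> (\<pi> s)"
    and bij: "bij_betw \<phi> (carrier G) (carrier H)"
    and \<phi>_one: "\<phi> \<one> = \<one>\<^bsub>H\<^esub>"
    and \<phi>_step: "g \<in> carrier G \<Longrightarrow> s \<in> S \<Longrightarrow>
      \<phi> (g \<otimes> s) \<in> {\<phi> g \<otimes>\<^bsub>H\<^esub> \<pi> s, \<phi> g \<otimes>\<^bsub>H\<^esub> inv\<^bsub>H\<^esub> (\<pi> s)}"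
    and induct_S [consumes 1, case_names one step]: "g \<in> carrier G \<Longrightarrow> P \<one> \<Longrightarrow>
      (\<And>g s. g \<in> carrier G \<Longrightarrow> s \<in> S \<Longrightarrow> P g \<Longrightarrow> P (g \<otimes> s)) \<Longrightarrow> P g"
begin

lemma \<phi>_closed: "g \<in> carrier G \<Longrightarrow> \<phi> g \<in> carrier H"
  using bij by (auto simp: bij_betw_def)

lemma \<phi>_eq_iff: "x \<in> carrier G \<Longrightarrow> y \<in> carrier G \<Longrightarrow> \<phi> x = \<phi> y \<longleftrightarrow> x = y"
  using bij by (auto simp: bij_betw_def inj_on_def)

lemma \<phi>_stepE:
  assumes "g \<in> carrier G" "s \<in> S"
  obtains u where "u \<in> {\<pi> s, inv\<^bsub>H\<^esub> (\<pi> s)}" "u \<in> carrier H" "\<phi> (g \<otimes> s) = \<phi> g \<otimes>\<^bsub>H\<^esub> u"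
  using \<phi>_step[OF assms] \<pi>_closed[OF assms(2)] by blast

text \<open>A change of sign would lead back to \<open>\<phi> g\<close>, so
  \<open>s \<otimes> s = \<one>\<close> by injectivity. Then \<open>\<pi>_inv\<close> makes
  \<open>\<pi> s\<close> its own inverse, and the two signs agree.\<close>

lemma \<phi>_step_twice:
  assumes g: "g \<in> carrier G" and s: "s \<in> S" and u: "u \<in> carrier H"
    and eq: "\<phi> (g \<otimes> s) = \<phi> g \<otimes>\<^bsub>H\<^esub> u"
  shows "\<phi> (g \<otimes> s \<otimes> s) = \<phi> (g \<otimes> s) \<otimes>\<^bsub>H\<^esub> u"
proof -
  note [simp] = g S_closed[OF s] \<pi>_closed[OF s] u \<phi>_closed
  have u': "u \<in> {\<pi> s, inv\<^bsub>H\<^esub> (\<pi> s)}" using \<phi>_step[OF g s] eq by auto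
  have "\<phi> (g \<otimes> s \<otimes> s) = \<phi> (g \<otimes> s) \<otimes>\<^bsub>H\<^esub> u \<or> \<phi> (g \<otimes> s \<otimes> s) = \<phi> (g \<otimes> s) \<otimes>\<^bsub>H\<^esub> inv\<^bsub>H\<^esub> u"
    using \<phi>_step[of "g \<otimes> s" s] s u' by auto
  then show ?thesis
  proof
    assume *: "\<phi> (g \<otimes> s \<otimes> s) = \<phi> (g \<otimes> s) \<otimes>\<^bsub>H\<^esub> inv\<^bsub>H\<^esub> u"
    then have "\<phi> (g \<otimes> s \<otimes> s) = \<phi> g" by (simp add: eq H.m_assoc)
    then have "g \<otimes> (s \<otimes> s) = g \<otimes> \<one>" by (simp add: \<phi>_eq_iff G.m_assoc)
    then have "s \<otimes> s = \<one>" by simp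
    then have "inv s = s" by (simp add: G.inv_equality)
    then have "inv\<^bsub>H\<^esub> (\<pi> s) = \<pi> s" using \<pi>_inv[OF s] by simp
    then show ?thesis using * u' by auto
  qed
qed

lemma \<phi>_square_step:
  assumes "g \<in> carrier G" and "s \<in> S" and "u \<in> carrier H" and "\<phi> (g \<otimes> s) = \<phi> g \<otimes>\<^bsub>H\<^esub> u"
  shows "\<phi> (g \<otimes> (s \<otimes> s)) = \<phi> g \<otimes>\<^bsub>H\<^esub> (u \<otimes>\<^bsub>H\<^esub> u)"
  using \<phi>_step_twice[OF assms] assms S_closed[OF assms(2)] \<phi>_closed[OF assms(1)]
  by (simp add: G.m_assoc H.m_assoc)

text \<open>Serves to compare the fourth powers of \<open>s\<close> and \<open>u\<close>: by
  cancellation and injectivity of \<open>\<phi>\<close>, one is trivial exactly when the other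
  is.\<close>

lemma \<phi>_fourth_step:
  assumes g: "g \<in> carrier G" and s: "s \<in> S" and u: "u \<in> carrier H"
    and eq: "\<phi> (g \<otimes> s) = \<phi> g \<otimes>\<^bsub>H\<^esub> u"
  shows "\<phi> (g \<otimes> ((s \<otimes> s) \<otimes> (s \<otimes> s))) = \<phi> g \<otimes>\<^bsub>H\<^esub> ((u \<otimes>\<^bsub>H\<^esub> u) \<otimes>\<^bsub>H\<^esub> (u \<otimes>\<^bsub>H\<^esub> u))"
proof -
  note [simp] = g S_closed[OF s] u \<phi>_closed
  have "\<phi> (g \<otimes> s \<otimes> s \<otimes> s) = \<phi> (g \<otimes> s \<otimes> s) \<otimes>\<^bsub>H\<^esub> u"
    by (rule \<phi>_step_twice) (simp_all add: s \<phi>_step_twice[OF g s u eq])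
  then have "\<phi> (g \<otimes> s \<otimes> s \<otimes> (s \<otimes> s)) = \<phi> (g \<otimes> s \<otimes> s) \<otimes>\<^bsub>H\<^esub> (u \<otimes>\<^bsub>H\<^esub> u)"
    using s by (intro \<phi>_square_step) auto
  moreover have "\<phi> (g \<otimes> s \<otimes> s) = \<phi> g \<otimes>\<^bsub>H\<^esub> (u \<otimes>\<^bsub>H\<^esub> u)"
    using \<phi>_square_step[OF g s u eq] by (simp add: G.m_assoc)
  ultimately show ?thesis by (simp add: G.m_assoc H.m_assoc)
qed

text \<open>If the sign flipped between \<open>g\<close> and \<open>g \<otimes> t\<close>, the two
  routes around the square would force \<open>s \<otimes> s = t \<otimes> t\<close>. At
  \<open>g \<otimes> t\<close> this element would then act both by the square of \<open>u\<close>
  and by its inverse, so the fourth powers of \<open>u\<close> and of \<open>s\<close> would be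
  trivial.\<close>

lemma \<phi>_step_invariant:
  assumes s: "s \<in> S" and ord: "(s \<otimes> s) \<otimes> (s \<otimes> s) \<noteq> \<one>"
    and g: "g \<in> carrier G" and t: "t \<in> S" and u: "u \<in> carrier H"
    and eq: "\<phi> (g \<otimes> s) = \<phi> g \<otimes>\<^bsub>H\<^esub> u"
  shows "\<phi> (g \<otimes> t \<otimes> s) = \<phi> (g \<otimes> t) \<otimes>\<^bsub>H\<^esub> u"
proof (rule ccontr)
  assume neq: "\<phi> (g \<otimes> t \<otimes> s) \<noteq> \<phi> (g \<otimes> t) \<otimes>\<^bsub>H\<^esub> u"
  note [simp] = g S_closed[OF s] S_closed[OF t] \<pi>_closed[OF s] u \<phi>_closed
  have u': "u \<in> {\<pi> s, inv\<^bsub>H\<^esub> (\<pi> s)}" using \<phi>_step[OF g s] eq by auto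
  have gts: "\<phi> (g \<otimes> t \<otimes> s) = \<phi> (g \<otimes> t) \<otimes>\<^bsub>H\<^esub> inv\<^bsub>H\<^esub> u"
    using \<phi>_step[of "g \<otimes> t" s] s u' neq by auto
  obtain v where v: "v \<in> {\<pi> t, inv\<^bsub>H\<^esub> (\<pi> t)}" "\<phi> (g \<otimes> t) = \<phi> g \<otimes>\<^bsub>H\<^esub> v" and [simp]: "v \<in> carrier H"
    using \<phi>_stepE[OF g t] by metis
  \<comment> \<open>This is the other route around the square; the sign of \<open>t\<close> at
    \<open>g \<otimes> s\<close> is still open.\<close>
  have "\<phi> (g \<otimes> s \<otimes> t) = \<phi> (g \<otimes> s) \<otimes>\<^bsub>H\<^esub> v \<or> \<phi> (g \<otimes> s \<otimes> t) = \<phi> (g \<otimes> s) \<otimes>\<^bsub>H\<^esub> inv\<^bsub>H\<^esub> v"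
    using \<phi>_step[of "g \<otimes> s" t] t v(1) \<pi>_closed[OF t] by auto
  moreover have "g \<otimes> s \<otimes> t = g \<otimes> t \<otimes> s" by (simp add: G.m_ac)
  ultimately have "\<phi> g \<otimes>\<^bsub>H\<^esub> (v \<otimes>\<^bsub>H\<^esub> inv\<^bsub>H\<^esub> u) = \<phi> g \<otimes>\<^bsub>H\<^esub> (v \<otimes>\<^bsub>H\<^esub> u)
      \<or> \<phi> g \<otimes>\<^bsub>H\<^esub> (v \<otimes>\<^bsub>H\<^esub> inv\<^bsub>H\<^esub> u) = \<phi> g \<otimes>\<^bsub>H\<^esub> (u \<otimes>\<^bsub>H\<^esub> inv\<^bsub>H\<^esub> v)"
    using gts v(2) eq by (simp add: H.m_assoc H.m_comm[of u])
  then have "v \<otimes>\<^bsub>H\<^esub> inv\<^bsub>H\<^esub> u = v \<otimes>\<^bsub>H\<^esub> u \<or> v \<otimes>\<^bsub>H\<^esub> inv\<^bsub>H\<^esub> u = u \<otimes>\<^bsub>H\<^esub> inv\<^bsub>H\<^esub> v"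
    by simp
  \<comment> \<open>The first alternative would make \<open>u\<close> its own inverse, and then no
    flip could be seen.\<close>
  moreover have "inv\<^bsub>H\<^esub> u \<noteq> u" using gts neq by auto
  ultimately have *: "v \<otimes>\<^bsub>H\<^esub> inv\<^bsub>H\<^esub> u = u \<otimes>\<^bsub>H\<^esub> inv\<^bsub>H\<^esub> v" by auto
  have vv: "v \<otimes>\<^bsub>H\<^esub> v = u \<otimes>\<^bsub>H\<^esub> u"
  proof -
    have "v \<otimes>\<^bsub>H\<^esub> v = (v \<otimes>\<^bsub>H\<^esub> inv\<^bsub>H\<^esub> u) \<otimes>\<^bsub>H\<^esub> (u \<otimes>\<^bsub>H\<^esub> v)" by (simp add: H.m_assoc H.m_assoc[symmetric, of "inv\<^bsub>H\<^esub> u"])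
    also have "\<dots> = u \<otimes>\<^bsub>H\<^esub> u" unfolding * by (simp add: H.m_ac)
    finally show ?thesis .
  qed
  have "\<phi> (g \<otimes> (s \<otimes> s)) = \<phi> (g \<otimes> (t \<otimes> t))"
    using \<phi>_square_step[OF g s u eq] \<phi>_square_step[OF g t _ v(2)] vv by simp
  then have "s \<otimes> s = t \<otimes> t" by (simp add: \<phi>_eq_iff)
  moreover have "\<phi> (g \<otimes> t \<otimes> (s \<otimes> s)) = \<phi> (g \<otimes> t) \<otimes>\<^bsub>H\<^esub> (inv\<^bsub>H\<^esub> u \<otimes>\<^bsub>H\<^esub> inv\<^bsub>H\<^esub> u)"
    using gts s by (intro \<phi>_square_step) auto
  moreover have "\<phi> (g \<otimes> t \<otimes> (t \<otimes> t)) = \<phi> (g \<otimes> t) \<otimes>\<^bsub>H\<^esub> (v \<otimes>\<^bsub>H\<^esub> v)"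
    using t \<phi>_step_twice[OF g t _ v(2)] by (intro \<phi>_square_step) auto
  ultimately have "inv\<^bsub>H\<^esub> (u \<otimes>\<^bsub>H\<^esub> u) = u \<otimes>\<^bsub>H\<^esub> u" using vv by (simp add: H.inv_mult)
  then have "(u \<otimes>\<^bsub>H\<^esub> u) \<otimes>\<^bsub>H\<^esub> (u \<otimes>\<^bsub>H\<^esub> u) = \<one>\<^bsub>H\<^esub>"
    by (metis H.r_inv H.m_closed u)
  then have "\<phi> (g \<otimes> ((s \<otimes> s) \<otimes> (s \<otimes> s))) = \<phi> g" using \<phi>_fourth_step[OF g s u eq] by simp
  then have "g \<otimes> ((s \<otimes> s) \<otimes> (s \<otimes> s)) = g \<otimes> \<one>" by (simp add: \<phi>_eq_iff)
  then show False using ord by simp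
qed

section \<open>Periods, and multiplicativity of the map modulo periods\<close>

definition periods :: "'a set" where
  "periods = {p \<in> carrier G. \<forall>g\<in>carrier G. \<phi> (g \<otimes> p) = \<phi> g \<otimes>\<^bsub>H\<^esub> \<phi> p}"

lemma periods_closed: "p \<in> periods \<Longrightarrow> p \<in> carrier G"
  by (simp add: periods_def)

lemma \<phi>_mult_period: "g \<in> carrier G \<Longrightarrow> p \<in> periods \<Longrightarrow> \<phi> (g \<otimes> p) = \<phi> g \<otimes>\<^bsub>H\<^esub> \<phi> p"
  by (simp add: periods_def)

lemma periodI:
  assumes p: "p \<in> carrier G" and u: "u \<in> carrier H"
    and eq: "\<And>g. g \<in> carrier G \<Longrightarrow> \<phi> (g \<otimes> p) = \<phi> g \<otimes>\<^bsub>H\<^esub> u"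
  shows "p \<in> periods"
proof -
  have "\<phi> p = u" using eq[of \<one>] p u by (simp add: \<phi>_one)
  then show ?thesis using p eq by (simp add: periods_def)
qed

lemma subgroup_periods: "subgroup periods G"
proof (rule G.subgroupI)
  show "periods \<subseteq> carrier G" by (auto simp: periods_def)
  have "\<one> \<in> periods" by (rule periodI[of _ "\<one>\<^bsub>H\<^esub>"]) (auto simp: \<phi>_closed)
  then show "periods \<noteq> {}" by blast
  show "p \<otimes> q \<in> periods" if "p \<in> periods" "q \<in> periods" for p q
  proof (rule periodI[of _ "\<phi> p \<otimes>\<^bsub>H\<^esub> \<phi> q"])
    note [simp] = that[THEN periods_closed] \<phi>_closed
    fix g assume [simp]: "g \<in> carrier G"
    have "\<phi> (g \<otimes> p \<otimes> q) = \<phi> g \<otimes>\<^bsub>H\<^esub> \<phi> p \<otimes>\<^bsub>H\<^esub> \<phi> q"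
      using that by (simp add: \<phi>_mult_period)
    then show "\<phi> (g \<otimes> (p \<otimes> q)) = \<phi> g \<otimes>\<^bsub>H\<^esub> (\<phi> p \<otimes>\<^bsub>H\<^esub> \<phi> q)"
      by (simp add: G.m_assoc H.m_assoc)
  qed (use that in \<open>auto simp: periods_closed \<phi>_closed\<close>)
  show "inv p \<in> periods" if "p \<in> periods" for p
  proof (rule periodI[of _ "inv\<^bsub>H\<^esub> (\<phi> p)"])
    note [simp] = periods_closed[OF that] \<phi>_closed
    fix g assume [simp]: "g \<in> carrier G"
    have "\<phi> (g \<otimes> inv p \<otimes> p) = \<phi> (g \<otimes> inv p) \<otimes>\<^bsub>H\<^esub> \<phi> p" using that by (intro \<phi>_mult_period) auto
    then have "\<phi> g = \<phi> (g \<otimes> inv p) \<otimes>\<^bsub>H\<^esub> \<phi> p" by (simp add: G.m_assoc)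
    then show "\<phi> (g \<otimes> inv p) = \<phi> g \<otimes>\<^bsub>H\<^esub> inv\<^bsub>H\<^esub> (\<phi> p)" by (simp add: H.m_assoc)
  qed (use that in \<open>auto simp: periods_closed \<phi>_closed\<close>)
qed

sublocale P: subgroup periods G by (rule subgroup_periods)

lemma \<phi>_inv_period: "p \<in> periods \<Longrightarrow> \<phi> (inv p) = inv\<^bsub>H\<^esub> (\<phi> p)"
  using \<phi>_mult_period[of "inv p" p] periods_closed[of p]
  by (metis G.inv_closed G.l_inv H.inv_equality \<phi>_closed \<phi>_one)

lemma square_generator_period:
  assumes s: "s \<in> S"
  shows "s \<otimes> s \<in> periods"
proof (cases "(s \<otimes> s) \<otimes> (s \<otimes> s) = \<one>")
  note [simp] = S_closed[OF s] \<pi>_closed[OF s] \<phi>_closed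
  case True
  show ?thesis
  proof (rule periodI[of _ "\<pi> s \<otimes>\<^bsub>H\<^esub> \<pi> s"])
    fix g assume g[simp]: "g \<in> carrier G"
    obtain u where u: "u \<in> {\<pi> s, inv\<^bsub>H\<^esub> (\<pi> s)}" "\<phi> (g \<otimes> s) = \<phi> g \<otimes>\<^bsub>H\<^esub> u" and [simp]: "u \<in> carrier H"
      using \<phi>_stepE[OF g s] by metis
    have "\<phi> g \<otimes>\<^bsub>H\<^esub> ((u \<otimes>\<^bsub>H\<^esub> u) \<otimes>\<^bsub>H\<^esub> (u \<otimes>\<^bsub>H\<^esub> u)) = \<phi> g \<otimes>\<^bsub>H\<^esub> \<one>\<^bsub>H\<^esub>"
      using \<phi>_fourth_step[OF g s _ u(2)] True by simp
    then have "(u \<otimes>\<^bsub>H\<^esub> u) \<otimes>\<^bsub>H\<^esub> (u \<otimes>\<^bsub>H\<^esub> u) = \<one>\<^bsub>H\<^esub>" by simp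
    \<comment> \<open>Being its own inverse, the square of \<open>u\<close> is the same for both
      possible values of \<open>u\<close>.\<close>
    then have "inv\<^bsub>H\<^esub> (u \<otimes>\<^bsub>H\<^esub> u) = u \<otimes>\<^bsub>H\<^esub> u" by (simp add: H.inv_equality)
    then have "u \<otimes>\<^bsub>H\<^esub> u = \<pi> s \<otimes>\<^bsub>H\<^esub> \<pi> s" using u(1) by (auto simp: H.inv_mult)
    then show "\<phi> (g \<otimes> (s \<otimes> s)) = \<phi> g \<otimes>\<^bsub>H\<^esub> (\<pi> s \<otimes>\<^bsub>H\<^esub> \<pi> s)"
      using \<phi>_square_step[OF g s _ u(2)] by simp
  qed auto
next
  note [simp] = S_closed[OF s] \<phi>_closed
  case False
  \<comment> \<open>The value of the step \<open>s\<close> at the identity is carried along all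
    generators, so \<open>s\<close> itself is a period.\<close>
  have "\<phi> (g \<otimes> s) = \<phi> g \<otimes>\<^bsub>H\<^esub> \<phi> s" if "g \<in> carrier G" for g
    using that
  proof (induction rule: induct_S)
    case one then show ?case by (simp add: \<phi>_one)
  next
    case (step g t) then show ?case using \<phi>_step_invariant[OF s False] by simp
  qed
  then have "s \<in> periods" by (intro periodI) auto
  then show ?thesis by blast
qed

text \<open>In the induction, the generator \<open>t\<close> is transported by \<open>u\<close> at
  \<open>y\<close> and by \<open>v\<close> at \<open>x \<otimes> y \<otimes> p\<close>. If these
  differ, they are mutually inverse, so \<open>u\<close> is \<open>v\<close> times the square of
  \<open>u\<close>, which is the value of \<open>\<phi>\<close> at the period
  \<open>t \<otimes> t\<close>.\<close>

lemma \<phi>_mult_mod_periods: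
  assumes x: "x \<in> carrier G" and y: "y \<in> carrier G"
  shows "\<exists>p\<in>periods. \<phi> x \<otimes>\<^bsub>H\<^esub> \<phi> y = \<phi> (x \<otimes> y \<otimes> p)"
  using y
proof (induction rule: induct_S)
  case one
  then show ?case using x by (intro bexI[of _ \<one>]) (auto simp: \<phi>_one \<phi>_closed)
next
  case (step y t)
  note [simp] = x \<open>y \<in> carrier G\<close> \<phi>_closed S_closed[OF step(2)] \<pi>_closed[OF step(2)]
  obtain p where p: "p \<in> periods" "\<phi> x \<otimes>\<^bsub>H\<^esub> \<phi> y = \<phi> (x \<otimes> y \<otimes> p)" using step(3) by blast
  note [simp] = periods_closed[OF p(1)]
  obtain u where u: "u \<in> {\<pi> t, inv\<^bsub>H\<^esub> (\<pi> t)}" "\<phi> (y \<otimes> t) = \<phi> y \<otimes>\<^bsub>H\<^esub> u" and [simp]: "u \<in> carrier H"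
    using \<phi>_stepE[OF _ step(2)] step(1) by metis
  obtain v where v: "v \<in> {\<pi> t, inv\<^bsub>H\<^esub> (\<pi> t)}" "\<phi> (x \<otimes> y \<otimes> p \<otimes> t) = \<phi> (x \<otimes> y \<otimes> p) \<otimes>\<^bsub>H\<^esub> v"
    and [simp]: "v \<in> carrier H"
    using \<phi>_stepE[OF _ step(2), of "x \<otimes> y \<otimes> p"] by auto
  have tt: "t \<otimes> t \<in> periods" by (rule square_generator_period[OF step(2)])
  have "\<phi> y \<otimes>\<^bsub>H\<^esub> \<phi> (t \<otimes> t) = \<phi> y \<otimes>\<^bsub>H\<^esub> (u \<otimes>\<^bsub>H\<^esub> u)"
    using \<phi>_mult_period[OF _ tt, of y] \<phi>_square_step[OF _ step(2) _ u(2)] by simp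
  then have uu: "\<phi> (t \<otimes> t) = u \<otimes>\<^bsub>H\<^esub> u" by simp
  have "\<exists>q\<in>periods. u = v \<otimes>\<^bsub>H\<^esub> \<phi> q"
  proof (cases "u = v")
    case True
    then show ?thesis by (intro bexI[of _ \<one>]) (auto simp: \<phi>_one)
  next
    case False
    then have "v = inv\<^bsub>H\<^esub> u" using u(1) v(1) by auto
    then show ?thesis using tt uu by (intro bexI[of _ "t \<otimes> t"]) (simp_all flip: H.m_assoc)
  qed
  then obtain q where q: "q \<in> periods" "u = v \<otimes>\<^bsub>H\<^esub> \<phi> q" by blast
  note [simp] = periods_closed[OF q(1)]
  have "\<phi> x \<otimes>\<^bsub>H\<^esub> \<phi> (y \<otimes> t) = \<phi> (x \<otimes> y \<otimes> p) \<otimes>\<^bsub>H\<^esub> v \<otimes>\<^bsub>H\<^esub> \<phi> q"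
    using u(2) q(2) by (simp add: H.m_assoc flip: p(2))
  also have "\<dots> = \<phi> (x \<otimes> y \<otimes> p \<otimes> t \<otimes> q)"
    using q(1) v(2) by (subst \<phi>_mult_period) auto
  also have "x \<otimes> y \<otimes> p \<otimes> t \<otimes> q = x \<otimes> (y \<otimes> t) \<otimes> (p \<otimes> q)" by (simp add: G.m_ac)
  finally show ?case using p(1) q(1) by blast
qed

text \<open>Whichever sign a step \<open>t\<close> takes, the square of its transport is
  \<open>\<phi> (t \<otimes> t)\<close>; commutativity then splits the square of
  \<open>x \<otimes> t\<close> into two periods.\<close>

lemma \<phi>_square:
  assumes "x \<in> carrier G"
  shows "x \<otimes> x \<in> periods \<and> \<phi> (x \<otimes> x) = \<phi> x \<otimes>\<^bsub>H\<^esub> \<phi> x"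
  using assms
proof (induction rule: induct_S)
  case one
  then show ?case by (simp add: \<phi>_one)
next
  case (step x t)
  note [simp] = \<open>x \<in> carrier G\<close> \<phi>_closed S_closed[OF step(2)]
  have tt: "t \<otimes> t \<in> periods" by (rule square_generator_period[OF step(2)])
  obtain u where u: "\<phi> (x \<otimes> t) = \<phi> x \<otimes>\<^bsub>H\<^esub> u" and [simp]: "u \<in> carrier H"
    using \<phi>_stepE[OF _ step(2)] step(1) by metis
  have "\<phi> x \<otimes>\<^bsub>H\<^esub> \<phi> (t \<otimes> t) = \<phi> x \<otimes>\<^bsub>H\<^esub> (u \<otimes>\<^bsub>H\<^esub> u)"
    using \<phi>_mult_period[OF _ tt, of x] \<phi>_square_step[OF _ step(2) _ u] by simp
  then have uu: "\<phi> (t \<otimes> t) = u \<otimes>\<^bsub>H\<^esub> u" by simp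
  have eq: "x \<otimes> t \<otimes> (x \<otimes> t) = (x \<otimes> x) \<otimes> (t \<otimes> t)" by (simp add: G.m_ac)
  have "\<phi> ((x \<otimes> x) \<otimes> (t \<otimes> t)) = \<phi> (x \<otimes> t) \<otimes>\<^bsub>H\<^esub> \<phi> (x \<otimes> t)"
    using step(3) tt by (subst \<phi>_mult_period) (auto simp: uu u H.m_ac)
  then show ?case using step(3) tt unfolding eq by blast
qed


section \<open>Extension from the periods to an isomorphism\<close>

theorem isomorphic: "G \<cong> H"
proof -
  let ?GH = "G \<times>\<times> H"
  \<comment> \<open>\<open>R\<close> is the graph of \<open>\<phi>\<close> blurred by periods, and
    \<open>D\<close> is the unblurred graph over the periods. A subgroup of \<open>R\<close>
    complementary to \<open>T\<close> over \<open>D\<close> will be the graph of the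
    isomorphism.\<close>
  define R where "R = {(x, \<phi> (x \<otimes> p)) | x p. x \<in> carrier G \<and> p \<in> periods}"
  define T where "T = periods \<times> \<phi> ` periods"
  define D where "D = {(p, \<phi> p) | p. p \<in> periods}"
  interpret GH: comm_group ?GH
  proof (rule group.group_comm_groupI)
    show "Group.group ?GH" by (rule DirProd_group) (rule G.is_group H.is_group)+
  qed (auto simp: G.m_comm H.m_comm)
  note [simp] = \<phi>_closed periods_closed
  have inv[simp]: "inv\<^bsub>?GH\<^esub> (x, y) = (inv x, inv\<^bsub>H\<^esub> y)" if "x \<in> carrier G" "y \<in> carrier H" for x y
    using that by (simp add: G.is_group H.is_group)
  have DI: "(p, \<phi> p) \<in> D" if "p \<in> periods" for p using that by (auto simp: D_def)
  have RI: "(x, \<phi> (x \<otimes> p)) \<in> R" if "x \<in> carrier G" "p \<in> periods" for x p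
    using that by (auto simp: R_def)
  \<comment> \<open>Multiplicativity modulo periods at \<open>x\<close> and \<open>inv x\<close>
    leaves an error \<open>p\<close>, which \<open>inv p\<close> corrects.\<close>
  have inv_\<phi>: "\<exists>p\<in>periods. inv\<^bsub>H\<^esub> (\<phi> x) = \<phi> (inv x \<otimes> p)" if [simp]: "x \<in> carrier G" for x
  proof -
    obtain p where p: "p \<in> periods" "\<phi> x \<otimes>\<^bsub>H\<^esub> \<phi> (inv x) = \<phi> (x \<otimes> inv x \<otimes> p)"
      using \<phi>_mult_mod_periods[of x "inv x"] by auto
    then have "\<phi> p = \<phi> x \<otimes>\<^bsub>H\<^esub> \<phi> (inv x)" by simp
    moreover have "\<phi> (inv x \<otimes> inv p) = \<phi> (inv x) \<otimes>\<^bsub>H\<^esub> inv\<^bsub>H\<^esub> (\<phi> p)"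
      using p(1) by (simp add: \<phi>_mult_period \<phi>_inv_period)
    ultimately have "\<phi> (inv x \<otimes> inv p) = inv\<^bsub>H\<^esub> (\<phi> x)"
      by (simp add: H.inv_mult H.m_lcomm)
    then show ?thesis using p(1) by (intro bexI[of _ "inv p"]) auto
  qed
  have "subgroup R ?GH"
  proof (rule GH.subgroupI)
    show "R \<subseteq> carrier ?GH" by (auto simp: R_def)
    show "R \<noteq> {}" using RI[of \<one> \<one>] by auto
  next
    fix a assume "a \<in> R"
    then obtain x p where [simp]: "a = (x, \<phi> (x \<otimes> p))" "x \<in> carrier G" and p: "p \<in> periods"
      by (auto simp: R_def)
    obtain q where q: "q \<in> periods" "inv\<^bsub>H\<^esub> (\<phi> (x \<otimes> p)) = \<phi> (inv (x \<otimes> p) \<otimes> q)"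
      using inv_\<phi>[of "x \<otimes> p"] p by auto
    then have "inv\<^bsub>?GH\<^esub> a = (inv x, \<phi> (inv x \<otimes> (inv p \<otimes> q)))"
      using p by (simp add: G.inv_mult G.m_assoc)
    then show "inv\<^bsub>?GH\<^esub> a \<in> R" using p q(1) by (auto intro!: RI)
  next
    fix a b assume "a \<in> R" "b \<in> R"
    then obtain x p y q where [simp]: "a = (x, \<phi> (x \<otimes> p))" "x \<in> carrier G" "b = (y, \<phi> (y \<otimes> q))" "y \<in> carrier G"
      and p: "p \<in> periods" "q \<in> periods"
      by (auto simp: R_def)
    obtain r where r: "r \<in> periods" "\<phi> (x \<otimes> p) \<otimes>\<^bsub>H\<^esub> \<phi> (y \<otimes> q) = \<phi> ((x \<otimes> p) \<otimes> (y \<otimes> q) \<otimes> r)"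
      using \<phi>_mult_mod_periods[of "x \<otimes> p" "y \<otimes> q"] p by auto
    then have "a \<otimes>\<^bsub>?GH\<^esub> b = (x \<otimes> y, \<phi> (x \<otimes> y \<otimes> (p \<otimes> q \<otimes> r)))"
      using p by (simp add: G.m_ac)
    then show "a \<otimes>\<^bsub>?GH\<^esub> b \<in> R" using p r(1) by (auto intro!: RI)
  qed
  moreover have "subgroup D ?GH"
  proof (rule GH.subgroupI)
    show "D \<subseteq> carrier ?GH" by (auto simp: D_def)
    show "D \<noteq> {}" using DI[of \<one>] by auto
  next
    fix a assume "a \<in> D"
    then show "inv\<^bsub>?GH\<^esub> a \<in> D" using DI by (auto simp: D_def simp flip: \<phi>_inv_period)
  next
    fix a b assume "a \<in> D" "b \<in> D"
    then show "a \<otimes>\<^bsub>?GH\<^esub> b \<in> D" using DI by (auto simp: D_def simp flip: \<phi>_mult_period)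
  qed
  moreover have "subgroup T ?GH"
    unfolding T_def
  proof (rule DirProd_subgroups)
    show "subgroup (\<phi> ` periods) H"
    proof (rule H.subgroupI)
      fix a assume "a \<in> \<phi> ` periods"
      then show "inv\<^bsub>H\<^esub> a \<in> \<phi> ` periods" by (auto simp flip: \<phi>_inv_period)
    next
      fix a b assume "a \<in> \<phi> ` periods" "b \<in> \<phi> ` periods"
      then show "a \<otimes>\<^bsub>H\<^esub> b \<in> \<phi> ` periods" by (auto simp flip: \<phi>_mult_period)
    next
      show "\<phi> ` periods \<noteq> {}" using P.one_closed by blast
    qed auto
  qed (rule G.is_group H.is_group subgroup_periods)+
  moreover have "D \<subseteq> R" using RI[of _ \<one>] by (fastforce simp: D_def)
  moreover have "D \<subseteq> T" by (auto simp: D_def T_def)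
  moreover have "\<exists>t\<in>T. r \<otimes>\<^bsub>?GH\<^esub> t \<in> R \<and> (r \<otimes>\<^bsub>?GH\<^esub> t) \<otimes>\<^bsub>?GH\<^esub> (r \<otimes>\<^bsub>?GH\<^esub> t) \<in> D" if "r \<in> R" for r
  proof -
    obtain x p where [simp]: "r = (x, \<phi> (x \<otimes> p))" "x \<in> carrier G" and p: "p \<in> periods"
      using \<open>r \<in> R\<close> by (auto simp: R_def)
    \<comment> \<open>An element of \<open>T\<close> moves \<open>r\<close> onto the graph of
      \<open>\<phi>\<close>, where \<open>\<phi>_square\<close> puts squares into
      \<open>D\<close>.\<close>
    have "r \<otimes>\<^bsub>?GH\<^esub> (\<one>, \<phi> (inv p)) = (x, \<phi> x)"
      using p by (simp add: \<phi>_inv_period \<phi>_mult_period H.m_assoc)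
    moreover have "(\<one>, \<phi> (inv p)) \<in> T" using p by (auto simp: T_def)
    moreover have "(x, \<phi> x) \<in> R" using RI[of x \<one>] by simp
    moreover have "(x, \<phi> x) \<otimes>\<^bsub>?GH\<^esub> (x, \<phi> x) \<in> D" using \<phi>_square[of x] DI by fastforce
    ultimately show ?thesis by metis
  qed
  ultimately obtain \<Gamma> where \<Gamma>: "subgroup \<Gamma> ?GH" "\<Gamma> \<subseteq> R" "\<Gamma> \<inter> T = D"
    and ex: "\<And>r. r \<in> R \<Longrightarrow> \<exists>t\<in>T. r \<otimes>\<^bsub>?GH\<^esub> t \<in> \<Gamma>"
    using GH.relative_complement_exists[of R T D] by metis
  interpret \<Gamma>: subgroup \<Gamma> ?GH by fact
  have \<Gamma>_closed: "x \<in> carrier G" "y \<in> carrier H" if "(x, y) \<in> \<Gamma>" for x y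
    using \<Gamma>.mem_carrier[OF that] by auto
  have \<Gamma>_mult: "(x \<otimes> x', y \<otimes>\<^bsub>H\<^esub> y') \<in> \<Gamma>" if "(x, y) \<in> \<Gamma>" "(x', y') \<in> \<Gamma>" for x y x' y'
    using \<Gamma>.m_closed[OF that] by simp
  have \<Gamma>_div: "(x \<otimes> inv x', y \<otimes>\<^bsub>H\<^esub> inv\<^bsub>H\<^esub> y') \<in> \<Gamma>" if "(x, y) \<in> \<Gamma>" "(x', y') \<in> \<Gamma>" for x y x' y'
    using \<Gamma>.m_closed[OF that(1) \<Gamma>.m_inv_closed[OF that(2)]] \<Gamma>_closed[OF that(2)] by simp
  have meet: "\<exists>p q. p \<in> periods \<and> q \<in> periods \<and> (x \<otimes> p, \<phi> (x \<otimes> q)) \<in> \<Gamma>" if x[simp]: "x \<in> carrier G" for x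
  proof -
    have "(x, \<phi> x) \<in> R" using RI[of x \<one>] by simp
    then obtain t where t: "t \<in> T" "(x, \<phi> x) \<otimes>\<^bsub>?GH\<^esub> t \<in> \<Gamma>" using ex by blast
    then obtain p q where pq: "p \<in> periods" "q \<in> periods" "t = (p, \<phi> q)" by (auto simp: T_def)
    then have "(x \<otimes> p, \<phi> (x \<otimes> q)) \<in> \<Gamma>" using t(2) by (simp add: \<phi>_mult_period)
    then show ?thesis using pq by blast
  qed
  have D\<Gamma>: "(p, \<phi> p) \<in> \<Gamma>" if "p \<in> periods" for p using \<Gamma>(3) DI[OF that] by blast
  \<comment> \<open>Dividing by \<open>(p, \<phi> p)\<close> clears the error in the first
    coordinate; for \<open>surj\<close>, dividing by \<open>(q, \<phi> q)\<close> clears the one in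
    the second.\<close>
  have total: "\<exists>y. (x, y) \<in> \<Gamma>" if x[simp]: "x \<in> carrier G" for x
  proof -
    obtain p q where pq: "p \<in> periods" "(x \<otimes> p, \<phi> (x \<otimes> q)) \<in> \<Gamma>" using meet[OF x] by blast
    have "x \<otimes> p \<otimes> inv p = x" using pq(1) by (simp add: G.m_assoc)
    then show ?thesis using \<Gamma>_div[OF pq(2) D\<Gamma>[OF pq(1)]] by auto
  qed
  have surj: "\<exists>x. (x, y) \<in> \<Gamma>" if "y \<in> carrier H" for y
  proof -
    obtain x where [simp]: "x \<in> carrier G" "y = \<phi> x"
      using bij \<open>y \<in> carrier H\<close> by (auto simp: bij_betw_def)
    obtain p q where pq: "q \<in> periods" "(x \<otimes> p, \<phi> (x \<otimes> q)) \<in> \<Gamma>" using meet[of x] by auto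
    have "\<phi> (x \<otimes> q) \<otimes>\<^bsub>H\<^esub> inv\<^bsub>H\<^esub> (\<phi> q) = y" using pq(1) by (simp add: \<phi>_mult_period H.m_assoc)
    then show ?thesis using \<Gamma>_div[OF pq(2) D\<Gamma>[OF pq(1)]] by auto
  qed
  have D_one: "x = \<one> \<longleftrightarrow> y = \<one>\<^bsub>H\<^esub>" if "(x, y) \<in> D" for x y
    using that \<phi>_eq_iff[of x \<one>] by (auto simp: D_def \<phi>_one)
  \<comment> \<open>In either direction \<open>x\<close> turns out to be a period, so the pair lies
    in \<open>\<Gamma> \<inter> T = D\<close>, on the graph of the injective map
    \<open>\<phi>\<close>, which fixes the identity.\<close>
  have \<Gamma>_one: "x = \<one> \<longleftrightarrow> y = \<one>\<^bsub>H\<^esub>" if xy: "(x, y) \<in> \<Gamma>" for x y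
  proof -
    obtain p where [simp]: "x \<in> carrier G" and p: "y = \<phi> (x \<otimes> p)" "p \<in> periods"
      using subsetD[OF \<Gamma>(2) xy] by (auto simp: R_def)
    have T: "(x, y) \<in> T" if "x \<in> periods" using that p by (auto simp: T_def)
    show ?thesis
    proof
      assume "x = \<one>"
      then show "y = \<one>\<^bsub>H\<^esub>" using T D_one[of x y] xy \<Gamma>(3) by auto
    next
      assume "y = \<one>\<^bsub>H\<^esub>"
      then have "x \<otimes> p = \<one>" using p \<phi>_eq_iff[of "x \<otimes> p" \<one>] by (simp add: \<phi>_one)
      then have "x = inv p" using p(2) by (simp add: G.inv_equality)
      then show "x = \<one>" using T D_one[of x y] xy \<Gamma>(3) \<open>y = \<one>\<^bsub>H\<^esub>\<close> p(2) by auto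
    qed
  qed
  \<comment> \<open>Applying \<open>\<Gamma>_one\<close> to quotients shows that each coordinate of
    a point of \<open>\<Gamma>\<close> determines the other.\<close>
  have \<Gamma>_inj: "x = x' \<longleftrightarrow> y = y'" if "(x, y) \<in> \<Gamma>" "(x', y') \<in> \<Gamma>" for x x' y y'
    using \<Gamma>_one[OF \<Gamma>_div[OF that]] \<Gamma>_closed[OF that(1)] \<Gamma>_closed[OF that(2)]
    by (metis G.inv_closed G.inv_equality G.inv_inv H.inv_closed H.inv_equality H.inv_inv G.r_inv H.r_inv)
  define f where "f x = (SOME y. (x, y) \<in> \<Gamma>)" for x
  have f: "(x, f x) \<in> \<Gamma>" if "x \<in> carrier G" for x
    unfolding f_def using someI_ex[OF total[OF that]] .
  have "f \<in> iso G H"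
  proof (rule isoI)
    show "f \<in> hom G H"
    proof (rule homI)
      fix x y assume "x \<in> carrier G" "y \<in> carrier G"
      then show "f (x \<otimes> y) = f x \<otimes>\<^bsub>H\<^esub> f y"
        using \<Gamma>_inj[OF f \<Gamma>_mult[OF f f], of "x \<otimes> y" x y] by simp
    qed (use f \<Gamma>_closed in blast)
    show "bij_betw f (carrier G) (carrier H)"
      unfolding bij_betw_def
    proof
      show "inj_on f (carrier G)" using \<Gamma>_inj[OF f f] by (auto simp: inj_on_def)
      show "f ` carrier G = carrier H"
      proof
        show "f ` carrier G \<subseteq> carrier H" using f \<Gamma>_closed by blast
        show "carrier H \<subseteq> f ` carrier G"
        proof
          fix y assume "y \<in> carrier H"
          then obtain x where x: "(x, y) \<in> \<Gamma>" using surj by blast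
          then have "f x = y" using \<Gamma>_inj[OF f x] \<Gamma>_closed by blast
          then show "y \<in> f ` carrier G" using x \<Gamma>_closed by blast
        qed
      qed
    qed
  qed
  then show ?thesis by (rule is_isoI)
qed

end

section \<open>Reduction to a map that fixes the identity\<close>

theorem corollary1p3:
  fixes G\<^sub>1 :: "('a, 'm) monoid_scheme" and G\<^sub>2 :: "('b, 'n) monoid_scheme"
  assumes "comm_group G\<^sub>1" and "comm_group G\<^sub>2"
    and "\<exists>S\<^sub>1 S\<^sub>2 \<phi>. symmetric_subset G\<^sub>1 S\<^sub>1 \<and> symmetric_subset G\<^sub>2 S\<^sub>2 \<and>
           Digraph_Component.connected (with_proj (Cay G\<^sub>1 S\<^sub>1)) \<and>
           chromatic_isomorphism G\<^sub>1 S\<^sub>1 G\<^sub>2 S\<^sub>2 \<phi>"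
  shows "G\<^sub>1 \<cong> G\<^sub>2"
proof -
  interpret G: comm_group G\<^sub>1 by fact
  interpret H: comm_group G\<^sub>2 by fact
  obtain S\<^sub>1 S\<^sub>2 \<phi> \<pi> where S: "symmetric_subset G\<^sub>1 S\<^sub>1" "symmetric_subset G\<^sub>2 S\<^sub>2"
    and conn: "Digraph_Component.connected (with_proj (Cay G\<^sub>1 S\<^sub>1))"
    and iso: "graph_isomorphism \<phi> (Cay G\<^sub>1 S\<^sub>1) (Cay G\<^sub>2 S\<^sub>2)"
    and \<pi>: "bij_betw \<pi> S\<^sub>1 S\<^sub>2" "\<forall>s\<in>S\<^sub>1. \<pi> (inv\<^bsub>G\<^sub>1\<^esub> s) = inv\<^bsub>G\<^sub>2\<^esub> (\<pi> s)"
    and step: "\<forall>g\<in>carrier G\<^sub>1. \<forall>s\<in>S\<^sub>1.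
      \<phi> (g \<otimes>\<^bsub>G\<^sub>1\<^esub> s) \<in> {\<phi> g \<otimes>\<^bsub>G\<^sub>2\<^esub> \<pi> s, \<phi> g \<otimes>\<^bsub>G\<^sub>2\<^esub> inv\<^bsub>G\<^sub>2\<^esub> (\<pi> s)}"
    using assms(3) unfolding chromatic_isomorphism_def by blast
  have bij: "bij_betw \<phi> (carrier G\<^sub>1) (carrier G\<^sub>2)"
    using iso pair_sym_digraph_Cay[OF G.is_group S(1)] pair_sym_digraph_Cay[OF H.is_group S(2)]
    by (auto simp: graph_isomorphism_iff pair_sym_digraph_def Cay_def)
  have \<phi>: "\<phi> g \<in> carrier G\<^sub>2" if "g \<in> carrier G\<^sub>1" for g using bij that by (auto simp: bij_betw_def)
  have \<pi>_closed: "\<pi> s \<in> carrier G\<^sub>2" if "s \<in> S\<^sub>1" for s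
    using \<pi>(1) S(2) that by (auto simp: bij_betw_def symmetric_subset_def)
  \<comment> \<open>Left translation by \<open>?c\<close> sends the image of the identity to the
    identity and, by associativity, preserves the step condition with the same
    \<open>\<pi>\<close>.\<close>
  let ?c = "inv\<^bsub>G\<^sub>2\<^esub> (\<phi> \<one>\<^bsub>G\<^sub>1\<^esub>)"
  have c: "?c \<in> carrier G\<^sub>2" using \<phi> by simp
  interpret pointed_chromatic_map G\<^sub>1 G\<^sub>2 S\<^sub>1 \<pi> "\<lambda>g. ?c \<otimes>\<^bsub>G\<^sub>2\<^esub> \<phi> g"
  proof unfold_locales
    have "bij_betw (\<lambda>y. ?c \<otimes>\<^bsub>G\<^sub>2\<^esub> y) (carrier G\<^sub>2) (carrier G\<^sub>2)"
      using c by (intro bij_betwI[of _ _ _ "\<lambda>y. \<phi> \<one>\<^bsub>G\<^sub>1\<^esub> \<otimes>\<^bsub>G\<^sub>2\<^esub> y"]) (auto simp: \<phi> simp flip: H.m_assoc)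
    from bij_betw_trans[OF bij this]
    show "bij_betw (\<lambda>g. ?c \<otimes>\<^bsub>G\<^sub>2\<^esub> \<phi> g) (carrier G\<^sub>1) (carrier G\<^sub>2)" by (simp add: o_def)
  next
    fix g s assume "g \<in> carrier G\<^sub>1" "s \<in> S\<^sub>1"
    then show "?c \<otimes>\<^bsub>G\<^sub>2\<^esub> \<phi> (g \<otimes>\<^bsub>G\<^sub>1\<^esub> s) \<in> {?c \<otimes>\<^bsub>G\<^sub>2\<^esub> \<phi> g \<otimes>\<^bsub>G\<^sub>2\<^esub> \<pi> s, ?c \<otimes>\<^bsub>G\<^sub>2\<^esub> \<phi> g \<otimes>\<^bsub>G\<^sub>2\<^esub> inv\<^bsub>G\<^sub>2\<^esub> (\<pi> s)}"
      using step[rule_format, of g s] \<pi>_closed[of s] \<phi>[of g] c by (auto simp: H.m_assoc)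
  next
    fix g P assume "g \<in> carrier G\<^sub>1" "P \<one>\<^bsub>G\<^sub>1\<^esub>"
      "\<And>g s. g \<in> carrier G\<^sub>1 \<Longrightarrow> s \<in> S\<^sub>1 \<Longrightarrow> P g \<Longrightarrow> P (g \<otimes>\<^bsub>G\<^sub>1\<^esub> s)"
    then show "P g" by (rule Cay_connected_induct[OF G.is_group S(1) conn])
  qed (use S(1) \<pi>(2) \<pi>_closed \<phi> in \<open>auto simp: symmetric_subset_def\<close>)
  show ?thesis by (rule isomorphic)
qed

end
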